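(* Let $p$ be a prime, $q=p^f$ with $f\ge1$, let $k\mid q-1$, and let $A_k=\{x^k:x\in\mathbb{F}_q^\times\}$ be a proper subgroup of $\mathbb{F}_q^\times$ with $\mathbb{F}_p(A_k)=\mathbb{F}_q$ and order $t=|A_k|=(q-1)/k\ge5$. If $A_k=S+T$ for subsets $S,T\subseteq\mathbb{F}_q$ with $|S|,|T|\ge2$, then $$3\le |S|\le \frac t2\quad\text{and}\quad 3\le|T|\le\frac t2,$$ and if $k\ge3$ then the upper bounds are strict: $|S|<t/2$ and $|T|<t/2$.
   Context: $S+T=\{s+u:s\in S,\ u\in T\}$ is the sumset in the additive group of $\mathbb{F}_q$. $\mathbb{F}_p(A_k)$ denotes the smallest subfield of $\mathbb{F}_q$ containing $A_k$. $A_k$ is the unique subgroup of index $k$ in $\mathbb{F}_q^\times$. *)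

theory Defs
  imports
    Complex_Main
    "HOL-Library.Set_Algebras"
    "HOL-Library.Cardinality"
    "HOL-Computational_Algebra.Primes"
begin

text \<open>
  The field \<open>\<bbbF>\<^sub>q\<close> is a type of sort \<open>{field, finite}\<close> with \<open>CARD('a) = q\<close>; the sumset
  \<open>S + T\<close> is the one of \<open>HOL-Library.Set_Algebras\<close>.
\<close>

definition power_subgroup :: "nat \<Rightarrow> 'a::field set" where
  "power_subgroup k = {x ^ k | x. x \<noteq> 0}"

(* The condition on inverses also covers 0, because inverse 0 = 0. *)
definition is_subfield :: "'a::field set \<Rightarrow> bool" where
  "is_subfield K \<longleftrightarrow> 0 \<in> K \<and> 1 \<in> K \<and>
     (\<forall>x\<in>K. \<forall>y\<in>K. x + y \<in> K \<and> x * y \<in> K) \<and>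
     (\<forall>x\<in>K. - x \<in> K \<and> inverse x \<in> K)"

(* Every subfield contains the prime field, so for a field of characteristic p
   this is the field obtained by adjoining A to F_p. *)
definition generated_subfield :: "'a::field set \<Rightarrow> 'a set" where
  "generated_subfield A = is_subfield hull A"

lemma is_subfield_generated_subfield: "is_subfield (generated_subfield A)"
  unfolding generated_subfield_def hull_def is_subfield_def by auto

lemma subset_generated_subfield: "A \<subseteq> generated_subfield A"
  unfolding generated_subfield_def by (rule hull_subset)

lemma generated_subfield_minimal:
  "is_subfield K \<Longrightarrow> A \<subseteq> K \<Longrightarrow> generated_subfield A \<subseteq> K"
  unfolding generated_subfield_def by (rule hull_minimal)

end

theory Submission
  imports Defs "HOL-Computational_Algebra.Polynomial"
begin

text \<open>
  Let \<open>t = card A\<close> and \<open>s \<noteq> s'\<close> in \<open>S\<close>. On \<open>T\<close> both \<open>(x + s) ^ t\<close> and \<open>(x + s') ^ t\<close> are \<open>1\<close>, so every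
  element of \<open>T\<close> is a double root of \<open>(x + s) ^ (t + 1) - (x + s') ^ (t + 1) - (s - s')\<close>, which has
  degree at most \<open>t\<close> and is nonzero. Hence \<open>2 * card T \<le> t\<close>. In case of equality the polynomial is
  \<open>(t + 1) * (s - s')\<close> times the square of \<open>h = (\<Prod>w\<in>T. x - w)\<close>. The coefficient of \<open>x ^ (t - 1)\<close> then
  determines \<open>s + s'\<close>, so \<open>S\<close> has only two elements; this case is refuted with power
  sums. So \<open>2 * card T < t\<close>, and since \<open>t \<le> card S * card T\<close>, also \<open>card S \<noteq> 2\<close>.
\<close>

section \<open>Divisibility and coefficient identities for products of linear factors\<close>

lemma square_linear_factors_dvd:
  fixes f :: "'a::field poly"
  assumes "finite W"
    and "\<And>w. w \<in> W \<Longrightarrow> poly f w = 0"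
    and "\<And>w. w \<in> W \<Longrightarrow> poly (pderiv f) w = 0"
  shows "(\<Prod>w\<in>W. [:-w, 1:])\<^sup>2 dvd f"
  using assms
proof (induction W rule: finite_induct)
  case empty
  then show ?case by simp
next
  case (insert a W)
  define h where "h = (\<Prod>w\<in>W. [:-w, 1:])"
  have "h\<^sup>2 dvd f"
    using insert by (simp add: h_def)
  then obtain g where g: "f = h\<^sup>2 * g" by (rule dvdE)
  \<comment> \<open>Since \<open>h\<close> does not vanish at \<open>a\<close>, the zeros of
    \<open>f\<close> and \<open>pderiv f\<close> there pass to \<open>g\<close> and then to
    \<open>pderiv g\<close>, so \<open>a\<close> is a double root of \<open>g\<close>.\<close>
  have ha: "poly h a \<noteq> 0"
    using insert.hyps by (auto simp: h_def poly_prod)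
  have ga: "poly g a = 0"
    using insert.prems(1)[of a] ha by (simp add: g)
  then obtain g' where g': "g = [:-a, 1:] * g'"
    by (auto simp: poly_eq_0_iff_dvd)
  have "pderiv f = h\<^sup>2 * pderiv g + g * pderiv (h\<^sup>2)"
    by (simp add: g pderiv_mult)
  then have "poly (pderiv g) a = 0"
    using insert.prems(2)[of a] ha ga by simp
  moreover have "pderiv g = [:-a, 1:] * pderiv g' + g'"
    unfolding g' by (subst pderiv_mult) (simp add: pderiv_pCons)
  ultimately have "poly g' a = 0" by simp
  then obtain g'' where "g' = [:-a, 1:] * g''"
    by (auto simp: poly_eq_0_iff_dvd)
  then have "f = ([:-a, 1:] * h)\<^sup>2 * g''"
    unfolding g g' by (simp only: power2_eq_square mult_ac)
  then show ?case
    using insert.hyps by (simp add: h_def del: mult_pCons_left)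
qed

lemma monic_dvd_imp_eq_smult:
  fixes f g :: "'a::field poly"
  assumes "g dvd f" "lead_coeff g = 1" "degree f \<le> degree g"
  shows "f = smult (coeff f (degree g)) g"
proof (cases "f = 0")
  case False
  from assms(1) obtain r where r: "f = g * r" by (rule dvdE)
  have "g \<noteq> 0" "r \<noteq> 0" using False r by auto
  then have "degree r = 0"
    using assms(3) r by (simp add: degree_mult_eq)
  then obtain c where "r = [:c:]" by (rule degree_eq_zeroE)
  then have "f = smult c g" using r by simp
  then show ?thesis using assms(2) by simp
qed simp

text \<open>Newton's identities: inserting \<open>a\<close> into \<open>W\<close> multiplies the
  product by \<open>1 - a * x\<close>, which turns \<open>c (j + 1)\<close> into
  \<open>c (j + 1) - a * c j\<close>. The factors 2, 3, 4 stay on the left because they may vanish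
  in \<open>'a\<close>.\<close>

lemma coeff_prod_linear_newton:
  fixes W :: "'a::idom set"
  assumes "finite W"
  defines "c \<equiv> coeff (\<Prod>w\<in>W. [:1, -w:])" and "p \<equiv> \<lambda>j. \<Sum>w\<in>W. w ^ j"
  shows "c 0 = 1" and "c 1 = - p 1" and "2 * c 2 = - (p 2 + c 1 * p 1)"
    and "3 * c 3 = - (p 3 + c 1 * p 2 + c 2 * p 1)"
    and "4 * c 4 = - (p 4 + c 1 * p 3 + c 2 * p 2 + c 3 * p 1)"
proof -
  have "c 0 = 1 \<and> c 1 = - p 1 \<and> 2 * c 2 = - (p 2 + c 1 * p 1) \<and>
    3 * c 3 = - (p 3 + c 1 * p 2 + c 2 * p 1) \<and>
    4 * c 4 = - (p 4 + c 1 * p 3 + c 2 * p 2 + c 3 * p 1)"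
    unfolding c_def p_def using assms(1)
  proof (induction W rule: finite_induct)
    case empty
    then show ?case by simp
  next
    case (insert a W)
    define d where "d = coeff (\<Prod>w\<in>W. [:1, -w:])"
    define q where "q = (\<lambda>j. \<Sum>w\<in>W. w ^ j)"
    have IH: "d 0 = 1" "d 1 = - q 1" "2 * d 2 = - (q 2 + d 1 * q 1)"
      "3 * d 3 = - (q 3 + d 1 * q 2 + d 2 * q 1)"
      "4 * d 4 = - (q 4 + d 1 * q 3 + d 2 * q 2 + d 3 * q 1)"
      using insert.IH unfolding d_def q_def by blast+
    have q: "(\<Sum>w\<in>insert a W. w ^ j) = a ^ j + q j" for j
      using insert.hyps by (simp add: q_def)
    have P: "(\<Prod>w\<in>insert a W. [:1, -w:]) = [:1, -a:] * (\<Prod>w\<in>W. [:1, -w:])"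
      using insert.hyps by simp
    have c0: "coeff (\<Prod>w\<in>insert a W. [:1, -w:]) 0 = d 0"
      unfolding P by (simp add: d_def)
    have cS: "coeff (\<Prod>w\<in>insert a W. [:1, -w:]) (Suc j) = d (Suc j) - a * d j" for j
      unfolding P by (simp add: d_def)
    have c: "coeff (\<Prod>w\<in>insert a W. [:1, -w:]) 1 = d 1 - a * d 0"
      "coeff (\<Prod>w\<in>insert a W. [:1, -w:]) 2 = d 2 - a * d 1"
      "coeff (\<Prod>w\<in>insert a W. [:1, -w:]) 3 = d 3 - a * d 2"
      "coeff (\<Prod>w\<in>insert a W. [:1, -w:]) 4 = d 4 - a * d 3"
      using cS[of 0] cS[of 1] cS[of 2] cS[of 3] by (simp_all add: eval_nat_numeral)
    show ?case
      unfolding c0 c q using IH by (intro conjI; algebra)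
  qed
  then show "c 0 = 1" "c 1 = - p 1" "2 * c 2 = - (p 2 + c 1 * p 1)"
    "3 * c 3 = - (p 3 + c 1 * p 2 + c 2 * p 1)"
    "4 * c 4 = - (p 4 + c 1 * p 3 + c 2 * p 2 + c 3 * p 1)"
    by blast+
qed

lemma card_roots_of_unity_le:
  fixes B :: "'a::field set"
  assumes "n > 0" "\<And>b. b \<in> B \<Longrightarrow> b ^ n = 1"
  shows "card B \<le> n"
proof -
  let ?f = "monom 1 n - 1 :: 'a poly"
  have "coeff ?f n = 1" using assms(1) by simp
  then have nz: "?f \<noteq> 0" by (metis coeff_0 zero_neq_one)
  have "B \<subseteq> {x. poly ?f x = 0}"
    using assms(2) by (auto simp: poly_monom)
  then have "card B \<le> card {x. poly ?f x = 0}"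
    by (intro card_mono poly_roots_finite nz)
  also have "\<dots> \<le> degree ?f" by (rule card_poly_roots_bound[OF nz])
  also have "\<dots> \<le> n" by (intro degree_diff_le) (simp_all add: degree_monom_le)
  finally show ?thesis .
qed

section \<open>The multiplicative subgroup: its order and power sums\<close>

locale proper_generating_subgroup =
  fixes A :: "'a::{field, finite} set"
  assumes one_mem: "1 \<in> A"
    and zero_not_mem: "0 \<notin> A"
    and mult_mem: "a \<in> A \<Longrightarrow> b \<in> A \<Longrightarrow> a * b \<in> A"
    and generates: "generated_subfield A = UNIV"
    and proper: "A \<noteq> UNIV - {0}"
begin

abbreviation t :: nat where "t \<equiv> card A"

lemma card_pos: "t > 0"
  using one_mem by (auto simp: card_gt_0_iff)

lemma mult_image_eq:
  assumes "a \<in> A"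
  shows "(*) a ` A = A" "inj_on ((*) a) A"
proof -
  show inj: "inj_on ((*) a) A"
    using assms zero_not_mem by (auto intro!: inj_onI)
  show "(*) a ` A = A"
    using assms mult_mem by (intro card_subset_eq card_image[OF inj]) auto
qed

text \<open>Multiplication by \<open>a\<close> permutes \<open>A\<close>, so the nonzero product of
  all elements is unchanged by the factor \<open>a ^ t\<close>.\<close>

lemma power_card_eq_1:
  assumes "a \<in> A"
  shows "a ^ t = 1"
proof -
  have "(\<Prod>x\<in>A. x) = (\<Prod>x\<in>(*) a ` A. x)"
    by (simp add: mult_image_eq[OF assms])
  also have "\<dots> = a ^ t * (\<Prod>x\<in>A. x)"
    by (subst prod.reindex[OF mult_image_eq(2)[OF assms]]) (simp add: prod.distrib)
  finally show ?thesis using zero_not_mem by simp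
qed

text \<open>The equation \<open>x ^ j = 1\<close> has at most \<open>j\<close> solutions, so some
  \<open>b\<close> in \<open>A\<close> violates it; multiplication by \<open>b\<close> permutes
  \<open>A\<close> yet multiplies the sum by \<open>b ^ j\<close>.\<close>

lemma sum_power_eq_0:
  assumes "0 < j" "j < t"
  shows "(\<Sum>a\<in>A. a ^ j) = 0"
proof -
  obtain b where b: "b \<in> A" "b ^ j \<noteq> 1"
    using card_roots_of_unity_le[OF assms(1), of A] assms(2) by force
  have "(\<Sum>a\<in>A. a ^ j) = (\<Sum>a\<in>(*) b ` A. a ^ j)"
    by (simp add: mult_image_eq[OF b(1)])
  also have "\<dots> = b ^ j * (\<Sum>a\<in>A. a ^ j)"
    by (subst sum.reindex[OF mult_image_eq(2)[OF b(1)]])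
      (simp add: sum_distrib_left power_mult_distrib)
  finally show ?thesis using b(2) by simp
qed

text \<open>Every \<open>a \<noteq> 1\<close> in \<open>A\<close> is a root of
  \<open>1 + x + ... + x ^ (t - 1)\<close>. If \<open>t\<close> vanished in the field, 1 would be a
  root too, giving \<open>t\<close> roots in degree at most \<open>t - 1\<close>.\<close>

lemma of_nat_card_neq_0: "of_nat t \<noteq> (0::'a)"
proof
  assume *: "of_nat t = (0::'a)"
  let ?g = "\<Sum>i<t. monom (1::'a) i"
  have "coeff ?g 0 = 1"
    using card_pos by (simp add: coeff_sum)
  then have nz: "?g \<noteq> 0" by (metis coeff_0 zero_neq_one)
  have g: "poly ?g x = (\<Sum>i<t. x ^ i)" for x
    by (simp add: poly_sum poly_monom)
  have "poly ?g a = 0" if "a \<in> A" for a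
  proof (cases "a = 1")
    case True
    then show ?thesis using * by (simp add: g)
  next
    case False
    then show ?thesis
      using power_card_eq_1[OF that] by (simp add: g sum_gp_strict)
  qed
  then have "t \<le> card {x. poly ?g x = 0}"
    by (intro card_mono) auto
  also have "\<dots> \<le> degree ?g" by (rule card_poly_roots_bound[OF nz])
  also have "\<dots> \<le> t - 1"
    by (intro degree_sum_le) (auto intro!: order.trans[OF degree_monom_le])
  finally show False using card_pos by simp
qed

section \<open>The auxiliary polynomial of Stepanov's method\<close>

definition stepanov :: "'a \<Rightarrow> 'a \<Rightarrow> 'a poly" where
  "stepanov s s' = [:s, 1:] ^ Suc t - [:s', 1:] ^ Suc t - [:s - s':]"

lemma coeff_stepanov:
  assumes "0 < i" "i \<le> Suc t"
  shows "coeff (stepanov s s') i =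
    of_nat (Suc t choose i) * (s ^ (Suc t - i) - s' ^ (Suc t - i))"
  using assms
  by (simp add: stepanov_def coeff_linear_poly_power coeff_pCons algebra_simps
      split: nat.splits del: power_Suc binomial_Suc_Suc)

lemma degree_stepanov_le: "degree (stepanov s s') \<le> t"
proof (rule degree_le, intro allI impI)
  fix i assume i: "t < i"
  show "coeff (stepanov s s') i = 0"
  proof (cases "i = Suc t")
    case True
    then show ?thesis using coeff_stepanov[of i s s'] by simp
  next
    case False
    then have "degree ([:x, 1:] ^ Suc t) < i" for x :: 'a
      using i by (simp add: degree_linear_power del: power_Suc)
    then have "coeff ([:x, 1:] ^ Suc t) i = 0" for x :: 'a
      by (rule coeff_eq_0)
    moreover have "coeff [:s - s':] i = 0"
      using i by (intro coeff_eq_0) simp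
    ultimately show ?thesis
      unfolding stepanov_def coeff_diff by simp
  qed
qed

text \<open>If the polynomial vanished, \<open>x \<mapsto> x ^ Suc t\<close> would be additive as well as
  multiplicative, and its fixed points \<open>A \<union> {0}\<close> would form a subfield.\<close>

lemma stepanov_neq_0:
  assumes "s \<noteq> s'"
  shows "stepanov s s' \<noteq> 0"
proof
  assume F: "stepanov s s' = 0"
  define d where "d = s - s'"
  have d: "d \<noteq> 0" using assms by (simp add: d_def)
  have shift: "(y + d) ^ Suc t = y ^ Suc t + d" for y
  proof -
    have "poly (stepanov s s') (y - s') = 0" by (simp add: F)
    then show ?thesis
      by (simp add: stepanov_def d_def algebra_simps del: power_Suc)
  qed
  have d_pow: "d ^ Suc t = d" using shift[of 0] by simp
  have add: "(u + v) ^ Suc t = u ^ Suc t + v ^ Suc t" for u v :: 'a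
  proof (cases "v = 0")
    case False
    \<comment> \<open>Scaling by \<open>v / d\<close> reduces adding \<open>v\<close> to adding
      \<open>d\<close>, the case given by \<open>shift\<close>.\<close>
    have "u + v = v / d * (u * d / v + d)"
      using d False by (simp add: distrib_left)
    then have "(u + v) ^ Suc t = (v / d * (u * d / v + d)) ^ Suc t"
      by (rule arg_cong)
    also have "\<dots> = (v / d) ^ Suc t * ((u * d / v) ^ Suc t + d ^ Suc t)"
      by (simp only: power_mult_distrib shift d_pow)
    also have "\<dots> = (v / d * (u * d / v)) ^ Suc t + (v / d * d) ^ Suc t"
      by (simp only: power_mult_distrib distrib_left)
    finally show ?thesis using d False by (simp del: power_Suc)
  qed simp
  let ?K = "{x::'a. x ^ Suc t = x}"
  have "is_subfield ?K"
    unfolding is_subfield_def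
  proof (intro conjI ballI)
    fix x y assume "x \<in> ?K" "y \<in> ?K"
    then show "x + y \<in> ?K" "x * y \<in> ?K"
      by (simp_all add: add power_mult_distrib del: power_Suc)
  next
    fix x assume x: "x \<in> ?K"
    show "- x \<in> ?K"
      using add[of x "-x"] x by (simp add: eq_neg_iff_add_eq_0 add.commute del: power_Suc)
    show "inverse x \<in> ?K"
      using x by (simp add: power_inverse del: power_Suc)
  qed auto
  moreover have "A \<subseteq> ?K" using power_card_eq_1 by auto
  ultimately have "?K = UNIV"
    using generated_subfield_minimal generates by blast
  then have "x ^ t = 1" if "x \<noteq> 0" for x :: 'a
    using that by (auto simp: set_eq_iff)
  then have "card (UNIV - {0::'a}) \<le> t"
    by (intro card_roots_of_unity_le card_pos) auto
  then have "A = UNIV - {0}"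
    using zero_not_mem by (intro card_seteq) auto
  then show False using proper by contradiction
qed

text \<open>At \<open>w\<close> the value is \<open>(s + w) - (s' + w) - (s - s') = 0\<close>, and
  the derivative is \<open>t + 1\<close> times
  \<open>(s + w) ^ t - (s' + w) ^ t = 1 - 1\<close>.\<close>

lemma square_dvd_stepanov:
  assumes "\<And>w. w \<in> W \<Longrightarrow> s + w \<in> A" "\<And>w. w \<in> W \<Longrightarrow> s' + w \<in> A"
  shows "(\<Prod>w\<in>W. [:-w, 1:])\<^sup>2 dvd stepanov s s'"
proof (rule square_linear_factors_dvd)
  fix w assume "w \<in> W"
  then have "(s + w) ^ t = 1" "(s' + w) ^ t = 1"
    using assms power_card_eq_1 by blast+
  then show "poly (stepanov s s') w = 0" "poly (pderiv (stepanov s s')) w = 0"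
    by (simp_all add: stepanov_def pderiv_diff pderiv_power_Suc pderiv_pCons del: power_Suc)
      (simp add: algebra_simps)
qed simp

lemma degree_square_linear_factors:
  "degree ((\<Prod>w\<in>W. [:-w, 1:])\<^sup>2 :: 'a poly) = 2 * card W"
  by (subst degree_power_eq) (auto simp: degree_prod_eq_sum_degree)

lemma two_card_le:
  assumes "s \<noteq> s'" "\<And>w. w \<in> W \<Longrightarrow> s + w \<in> A" "\<And>w. w \<in> W \<Longrightarrow> s' + w \<in> A"
  shows "2 * card W \<le> t"
proof -
  have "degree ((\<Prod>w\<in>W. [:-w, 1:])\<^sup>2) \<le> degree (stepanov s s')"
    using assms by (intro dvd_imp_degree_le square_dvd_stepanov stepanov_neq_0)
  then show ?thesis
    using degree_stepanov_le[of s s'] by (simp add: degree_square_linear_factors)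
qed

text \<open>The square already has degree \<open>t\<close>, so the quotient is a constant, namely
  the coefficient of \<open>x ^ t\<close>. It is nonzero because the polynomial is, hence so is
  \<open>t + 1\<close> in the field.\<close>

lemma stepanov_eq_square:
  assumes "s \<noteq> s'" "\<And>w. w \<in> W \<Longrightarrow> s + w \<in> A" "\<And>w. w \<in> W \<Longrightarrow> s' + w \<in> A"
    and "2 * card W = t"
  shows "stepanov s s' = smult (of_nat (Suc t) * (s - s')) ((\<Prod>w\<in>W. [:-w, 1:])\<^sup>2)"
    and "of_nat (Suc t) \<noteq> (0::'a)"
proof -
  let ?h = "\<Prod>w\<in>W. [:-w, 1:]"
  have deg: "degree (?h\<^sup>2) = t"
    using assms(4) by (simp only: degree_square_linear_factors)
  have "stepanov s s' = smult (coeff (stepanov s s') (degree (?h\<^sup>2))) (?h\<^sup>2)"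
    using assms(2,3)
  proof (intro monic_dvd_imp_eq_smult square_dvd_stepanov)
    show "lead_coeff (?h\<^sup>2) = 1"
      by (simp only: lead_coeff_power lead_coeff_prod) simp
    show "degree (stepanov s s') \<le> degree (?h\<^sup>2)"
      unfolding deg by (rule degree_stepanov_le)
  qed
  then have "stepanov s s' = smult (coeff (stepanov s s') t) (?h\<^sup>2)"
    unfolding deg .
  moreover have "coeff (stepanov s s') t = of_nat (Suc t) * (s - s')"
    using coeff_stepanov[of t s s'] card_pos by (simp del: of_nat_Suc)
  ultimately show eq: "stepanov s s' =
      smult (of_nat (Suc t) * (s - s')) ((\<Prod>w\<in>W. [:-w, 1:])\<^sup>2)"
    by simp
  show "of_nat (Suc t) \<noteq> (0::'a)"
    using eq stepanov_neq_0[OF assms(1)] by (auto simp del: of_nat_Suc)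
qed

section \<open>The equality case \<open>2 * card W = t\<close>\<close>

lemma no_three_translates:
  assumes "2 * card W = t" "t \<ge> 2"
    and "\<And>w. w \<in> W \<Longrightarrow> s1 + w \<in> A" "\<And>w. w \<in> W \<Longrightarrow> s2 + w \<in> A" "\<And>w. w \<in> W \<Longrightarrow> s3 + w \<in> A"
    and "s1 \<noteq> s2" "s1 \<noteq> s3"
  shows "s2 = s3"
proof -
  define u where "u = coeff ((\<Prod>w\<in>W. [:-w, 1:])\<^sup>2) (t - 1)"
  have t1: "of_nat (Suc t) \<noteq> (0::'a)"
    by (rule stepanov_eq_square(2)) (use assms in auto)
  have choose: "Suc t choose (t - 1) = Suc t choose 2"
    using binomial_symmetric[of "t - 1" "Suc t"] assms(2) by (simp add: Suc_diff_le numeral_2_eq_2 del: binomial_Suc_Suc)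
  \<comment> \<open>The square, and with it \<open>u\<close>, does not depend on \<open>s\<close>;
    dividing the coefficient of \<open>x ^ (t - 1)\<close> by \<open>s1 - s\<close> therefore ties
    \<open>s1 + s\<close> to a fixed value.\<close>
  have *: "of_nat (Suc t choose 2) * (s1 + s) = of_nat (Suc t) * u"
    if "s1 \<noteq> s" "\<And>w. w \<in> W \<Longrightarrow> s + w \<in> A" for s
  proof -
    have "coeff (stepanov s1 s) (t - 1) = of_nat (Suc t) * (s1 - s) * u"
      using stepanov_eq_square(1)[OF that(1) assms(3) that(2) assms(1)]
      by (simp add: u_def del: of_nat_Suc)
    moreover have "coeff (stepanov s1 s) (t - 1) =
        of_nat (Suc t choose 2) * (s1\<^sup>2 - s\<^sup>2)"
      using coeff_stepanov[of "t - 1" s1 s] assms(2) choose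
      by (simp add: Suc_diff_le numeral_2_eq_2 del: binomial_Suc_Suc power_Suc)
    ultimately have "(s1 - s) * (of_nat (Suc t choose 2) * (s1 + s)) =
        (s1 - s) * (of_nat (Suc t) * u)"
      by algebra
    then show ?thesis using that(1) by (simp del: of_nat_Suc binomial_Suc_Suc)
  qed
  \<comment> \<open>Both \<open>t\<close> and \<open>t + 1\<close> are nonzero in the field, so the
    binomial coefficient in \<open>*\<close> can be cancelled.\<close>
  have "2 * (Suc t choose 2) = Suc t * t"
    by (simp add: choose_two del: binomial_Suc_Suc)
  then have "2 * of_nat (Suc t choose 2) = (of_nat (Suc t) * of_nat t :: 'a)"
    by (metis of_nat_mult of_nat_numeral)
  then have "of_nat (Suc t choose 2) \<noteq> (0::'a)"
    using t1 of_nat_card_neq_0 by (metis mult_eq_0_iff mult_zero_right)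
  then show ?thesis
    using *[OF assms(6,4)] *[OF assms(7,5)] by (metis add_left_cancel mult_left_cancel)
qed

text \<open>The power sums of \<open>A\<close> vanish below \<open>t\<close>, which forces the power sums of \<open>W\<close>, and by Newton's
  identities the leading coefficients of \<open>(\<Prod>w\<in>W. x - w)\<close>. Comparing its square with
  \<open>stepanov e (- e)\<close> in two coefficients yields \<open>16 = 0\<close>, although \<open>2 \<noteq> 0\<close>. The comparison is made
  for the reflected polynomials, whose indices involve no truncated subtraction.\<close>

lemma no_two_translates:
  assumes "A = {e, -e} + W" "2 * card W = t" "t \<ge> 5"
  shows False
proof -
  define n where "n = card W"
  define \<nu> :: 'a where "\<nu> = of_nat n"
  define p where "p = (\<lambda>j. \<Sum>w\<in>W. w ^ j)"
  define c where "c = coeff (\<Prod>w\<in>W. [:1, -w:])"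
  have tn: "t = 2 * n" and n3: "n \<ge> 3" using assms by (auto simp: n_def)
  have nz: "\<nu> \<noteq> 0" "(2::'a) \<noteq> 0"
    using of_nat_card_neq_0 by (auto simp: tn \<nu>_def)
  have mem: "e + w \<in> A" "- e + w \<in> A" if "w \<in> W" for w
    using that unfolding assms(1) by (auto simp del: add_uminus_conv_diff uminus_add_conv_diff)
  have A_eq: "A = (+) e ` W \<union> (+) (- e) ` W"
    using assms(1) by (auto simp: set_plus_def)
  have cards: "card ((+) x ` W) = n" for x
    by (simp add: n_def card_image)
  \<comment> \<open>The two translates have \<open>n\<close> elements each and cover all
    \<open>2 * n\<close> elements of \<open>A\<close>, leaving no room for overlap.\<close>
  have disj: "(+) e ` W \<inter> (+) (- e) ` W = {}"
  proof -
    have "card ((+) e ` W \<inter> (+) (- e) ` W) = 0"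
      using card_Un_Int[of "(+) e ` W" "(+) (- e) ` W", folded A_eq] tn
      unfolding cards by simp
    then show ?thesis by simp
  qed
  have e: "e \<noteq> 0"
  proof
    assume "e = 0"
    then have "W = {}" using disj by auto
    then show False using n3 by (simp add: n_def)
  qed
  then have "e \<noteq> - e"
    using nz(2) by (metis add.right_inverse mult_2 mult_eq_0_iff)
  then have sq: "stepanov e (- e) = smult (of_nat (Suc t) * (e - - e)) ((\<Prod>w\<in>W. [:-w, 1:])\<^sup>2)"
    "of_nat (Suc t) \<noteq> (0::'a)"
    using stepanov_eq_square[of e "- e" W] mem assms(2) by blast+
  have psum: "(\<Sum>w\<in>W. (e + w) ^ j + (- e + w) ^ j) = 0" if "0 < j" "j < t" for j
  proof -
    have "(\<Sum>a\<in>A. a ^ j) = (\<Sum>w\<in>W. (e + w) ^ j) + (\<Sum>w\<in>W. (- e + w) ^ j)"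
      by (subst A_eq, subst sum.union_disjoint[OF _ _ disj])
        (simp_all add: sum.reindex del: add_uminus_conv_diff uminus_add_conv_diff)
    then show ?thesis using sum_power_eq_0[OF that] by (simp add: sum.distrib)
  qed
  have p0: "p 0 = \<nu>" by (simp add: p_def \<nu>_def n_def)
  have "(\<Sum>w\<in>W. (e + w) ^ 1 + (- e + w) ^ 1) = 2 * p 1"
    by (simp add: p_def sum_distrib_left)
  then have p1: "p 1 = 0" using psum[of 1] assms(3) nz by simp
  \<comment> \<open>Odd powers of \<open>e\<close> cancel between \<open>e\<close> and
    \<open>- e\<close>.\<close>
  have "2 * (p 2 + e^2 * p 0) = (\<Sum>w\<in>W. (e + w) ^ 2 + (- e + w) ^ 2)"
    unfolding p_def sum_distrib_left sum.distrib[symmetric]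
    by (intro sum.cong refl) algebra
  also have "\<dots> = 0" by (rule psum) (use assms(3) in auto)
  finally have "p 2 + e^2 * p 0 = 0" using nz(2) by (metis mult_eq_0_iff)
  then have p2: "p 2 = - \<nu> * e^2" unfolding p0 by algebra
  \<comment> \<open>The exponent 4 is admissible in \<open>psum\<close> because
    \<open>t \<ge> 5\<close>.\<close>
  have "2 * (p 4 + 6 * e^2 * p 2 + e^4 * p 0) = (\<Sum>w\<in>W. (e + w) ^ 4 + (- e + w) ^ 4)"
    unfolding p_def sum_distrib_left sum.distrib[symmetric]
    by (intro sum.cong refl) algebra
  also have "\<dots> = 0" by (rule psum) (use assms(3) in auto)
  finally have "p 4 + 6 * e^2 * p 2 + e^4 * p 0 = 0" using nz(2) by (metis mult_eq_0_iff)
  then have p4: "p 4 = 5 * \<nu> * e^4"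
    unfolding p0 p2 by algebra

  have p: "(\<Sum>w\<in>W. w ^ j) = p j" for j by (simp add: p_def)
  note newton = coeff_prod_linear_newton[OF finite, of W, folded c_def, unfolded p]
  \<comment> \<open>In the fourth identity \<open>p 3\<close> and \<open>c 3\<close> drop out, being
    multiplied by \<open>c 1 = 0\<close> and \<open>p 1 = 0\<close>.\<close>
  have c0: "c 0 = 1" and c1: "c 1 = 0" and c2: "2 * c 2 = \<nu> * e^2"
    and c4: "4 * c 4 = - (p 4 + c 2 * p 2)"
    using newton p1 p2 by simp_all
  have c4': "8 * c 4 = (\<nu>^2 - 10 * \<nu>) * e^4"
    using c4 c2 p2 p4 by algebra

  let ?H = "(\<Prod>w\<in>W. [:-w, 1:]) :: 'a poly"
  have refl_lin: "reflect_poly [:-w, 1:] = [:1, -w:]" for w :: 'a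
    by (cases "w = 0") (simp_all add: reflect_poly_def)
  have refl: "reflect_poly (?H\<^sup>2) = (\<Prod>w\<in>W. [:1, -w:])\<^sup>2"
    by (simp add: reflect_poly_power reflect_poly_prod refl_lin)
  have coeff_sq: "coeff ((\<Prod>w\<in>W. [:1, -w:])\<^sup>2) j = coeff (?H\<^sup>2) (t - j)" if "j < t" for j
    unfolding refl[symmetric] coeff_reflect_poly degree_square_linear_factors
    using that assms(2) by simp
  \<comment> \<open>Coefficient \<open>j\<close> of the reflected square is coefficient
    \<open>t - j\<close> of the square, and \<open>Suc t choose (t - j)\<close> equals
    \<open>Suc t choose Suc j\<close>.\<close>
  have main: "of_nat (Suc t) * (2 * e) * coeff ((\<Prod>w\<in>W. [:1, -w:])\<^sup>2) j =
      of_nat (Suc t choose Suc j) * (e ^ Suc j - (- e) ^ Suc j)" if "j < t" for j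
  proof -
    have "coeff (stepanov e (- e)) (t - j) =
        of_nat (Suc t) * (2 * e) * coeff ((\<Prod>w\<in>W. [:1, -w:])\<^sup>2) j"
      unfolding sq(1) coeff_sq[OF that] by simp
    moreover have "Suc t choose (t - j) = Suc t choose (Suc j)"
      using that binomial_symmetric[of "Suc j" "Suc t"] by simp
    moreover have "Suc t - (t - j) = Suc j" using that by simp
    ultimately show ?thesis
      using coeff_stepanov[of "t - j" e "- e"] that by (simp del: power_Suc of_nat_Suc binomial_Suc_Suc)
  qed
  have sq2: "coeff ((\<Prod>w\<in>W. [:1, -w:])\<^sup>2) 2 = 2 * c 2"
    using c0 c1 by (simp add: power2_eq_square coeff_mult c_def eval_nat_numeral)
  have sq4: "coeff ((\<Prod>w\<in>W. [:1, -w:])\<^sup>2) 4 = 2 * c 4 + c 2 ^ 2"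
    using c0 c1 by (simp add: power2_eq_square coeff_mult c_def eval_nat_numeral)
  define N where "N = (of_nat (Suc t) :: 'a)"
  define C3 where "C3 = (of_nat (Suc t choose 3) :: 'a)"
  define C5 where "C5 = (of_nat (Suc t choose 5) :: 'a)"
  have N: "N \<noteq> 0" "N = 2 * \<nu> + 1" using sq(2) by (simp_all add: N_def tn \<nu>_def)
  have "2 * e^3 * (N * \<nu>) = 2 * e^3 * C3"
  proof -
    have "N * (2 * e) * (2 * c 2) = C3 * (e ^ 3 - (- e) ^ 3)"
      using main[of 2] assms(3) unfolding sq2 by (simp add: N_def C3_def del: of_nat_Suc binomial_Suc_Suc power_Suc)
    then show ?thesis using c2 by algebra
  qed
  then have C3: "C3 = N * \<nu>" using e nz by simp
  have "2 * e^5 * (N * (\<nu>^2 - 5 * \<nu>)) = 2 * e^5 * (2 * C5)"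
  proof -
    have "N * (2 * e) * (2 * c 4 + c 2 ^ 2) = C5 * (e ^ 5 - (- e) ^ 5)"
      using main[of 4] assms(3) unfolding sq4 by (simp add: N_def C5_def del: of_nat_Suc binomial_Suc_Suc power_Suc)
    then have "2 * (2 * e^5 * (N * (\<nu>^2 - 5 * \<nu>))) = 2 * (2 * e^5 * (2 * C5))"
      using c2 c4' by algebra
    then show ?thesis by (rule mult_left_cancel[OF nz(2), THEN iffD1])
  qed
  moreover have "2 * e^5 \<noteq> 0" using e nz by simp
  ultimately have C5: "N * (\<nu>^2 - 5 * \<nu>) = 2 * C5"
    by (metis mult_left_cancel)
  \<comment> \<open>With \<open>n = m + 3\<close> one has \<open>Suc t = 2 * m + 7\<close>, so the
    ratios of consecutive binomial coefficients used below are free of subtraction.\<close>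
  obtain m where m: "n = m + 3" using n3 by (metis le_add_diff_inverse2)
  define \<mu> :: 'a where "\<mu> = of_nat m"
  have \<nu>: "\<nu> = \<mu> + 3" by (simp add: \<nu>_def \<mu>_def m)
  have absorb: "l * (Suc t choose l) = r * (Suc t choose k)"
    if "l = Suc k" "Suc t = r + k" for l k r
    using binomial_absorption[of k "Suc t"] binomial_absorb_comp[of "Suc t" k]
    unfolding that(1) by (simp only: that(2) add_diff_cancel_right')
  have "2 * (Suc t choose 2) = 2 * (m + 3) * (Suc t choose 1)"
    by (rule absorb) (simp_all add: tn m)
  then have C2: "Suc t choose 2 = (m + 3) * Suc t"
    unfolding mult.assoc choose_one by simp
  have "3 * (Suc t choose 3) = (2 * m + 5) * (Suc t choose 2)"
    by (rule absorb) (simp_all add: tn m)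
  then have "of_nat (3 * (Suc t choose 3)) = (of_nat ((2 * m + 5) * (Suc t choose 2)) :: 'a)"
    by (rule arg_cong)
  then have "3 * C3 = (2 * \<mu> + 5) * ((\<mu> + 3) * N)"
    unfolding C2 C3_def \<mu>_def N_def of_nat_mult of_nat_add of_nat_numeral .
  \<comment> \<open>Substituting \<open>C3 = N * \<nu>\<close> and cancelling
    \<open>N * \<nu>\<close> would leave \<open>3 = 2 * \<mu> + 5\<close>.\<close>
  then have "N * \<nu> * 2 * (\<mu> + 1) = 0"
    unfolding C3 \<nu> by algebra
  then have \<mu>: "\<mu> = - 1" using N nz by (simp add: eq_neg_iff_add_eq_0)
  have "4 * (Suc t choose 4) = 2 * (m + 2) * (Suc t choose 3)"
    by (rule absorb) (simp_all add: tn m)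
  then have C4: "2 * (Suc t choose 4) = (m + 2) * (Suc t choose 3)"
    unfolding mult.assoc by linarith
  have "5 * (Suc t choose 5) = (2 * m + 3) * (Suc t choose 4)"
    by (rule absorb) (simp_all add: tn m)
  then have "10 * (Suc t choose 5) = (2 * m + 3) * (2 * (Suc t choose 4))"
    by (simp del: binomial_Suc_Suc)
  then have "of_nat (10 * (Suc t choose 5)) =
      (of_nat ((2 * m + 3) * ((m + 2) * (Suc t choose 3))) :: 'a)"
    unfolding C4 by (rule arg_cong)
  then have "10 * C5 = (2 * \<mu> + 3) * ((\<mu> + 2) * C3)"
    unfolding C3_def C5_def \<mu>_def of_nat_mult of_nat_add of_nat_numeral .
  \<comment> \<open>Now \<open>\<nu> = 2\<close>, so \<open>2 * C5 = - 6 * N\<close>, while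
    \<open>10 * C5 = C3 = 2 * N\<close>; together \<open>32 * N = 0\<close>.\<close>
  then have "N * \<nu> * 2 ^ 4 = 0"
    using C5 unfolding C3 \<nu> \<mu> by algebra
  then show False using nz N by (simp only: mult_eq_0_iff power_eq_0_iff) simp
qed

section \<open>Bounds for the summands of \<open>A\<close>\<close>

lemma two_card_less:
  assumes "A = S + T" "card S \<ge> 2" "t \<ge> 5"
  shows "2 * card T < t"
proof (rule ccontr)
  assume "\<not> 2 * card T < t"
  have mem: "s + w \<in> A" if "s \<in> S" "w \<in> T" for s w
    using that assms(1) by (auto intro: set_plus_intro)
  obtain s1 s2 where s: "s1 \<in> S" "s2 \<in> S" "s1 \<noteq> s2"
    using assms(2) by (metis card_le_Suc0_iff_eq finite not_less_eq_eq numeral_2_eq_2)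
  have T: "2 * card T = t"
    using two_card_le[OF s(3) mem mem] s \<open>\<not> 2 * card T < t\<close> by force
  have "s3 = s2" if "s3 \<in> S" "s3 \<noteq> s1" for s3
    by (rule no_three_translates[OF T, of s1]) (use assms(3) mem s that in auto)
  then have S: "S = {s1, s2}" using s by blast
  have two: "(2::'a) \<noteq> 0"
    using of_nat_card_neq_0 unfolding T[symmetric] by auto
  \<comment> \<open>Half the difference \<open>e\<close> and the midpoint \<open>m\<close> present
    \<open>S\<close> as \<open>{e, - e}\<close> shifted by \<open>m\<close>; the shift is then moved
    to \<open>T\<close>.\<close>
  define e where "e = (s1 - s2) / 2"
  define m where "m = s1 - e"
  have "2 * e = s1 - s2" using two by (simp add: e_def)
  then have s12: "s1 = e + m" "s2 = - e + m"
    unfolding m_def by - algebra+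
  have "A = {e, - e} + (+) m ` T"
    unfolding assms(1) S s12 set_plus_def by (auto simp: add.assoc)
  moreover have "2 * card ((+) m ` T) = t"
    using T by (simp add: card_image)
  ultimately show False using no_two_translates assms(3) by blast
qed

lemma three_le_card:
  assumes "A = S + T" "card S \<ge> 2" "t \<ge> 5"
  shows "3 \<le> card S"
proof -
  have "t \<le> card S * card T"
    using card_image_le[of "S \<times> T" "\<lambda>(s, u). s + u"]
    by (simp add: assms(1) set_plus_image)
  then have "card S \<noteq> 2"
    using two_card_less[OF assms] by auto
  then show ?thesis using assms(2) by simp
qed

end

theorem theorem1p4:
  fixes p f k t :: nat
    and A S T :: "'a::{field, finite} set"
  assumes "prime p" and "f \<ge> 1" and "CARD('a) = p ^ f"
    and "k dvd CARD('a) - 1"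
    and "A = power_subgroup k"
    and "A \<noteq> UNIV - {0}"
    and "generated_subfield A = UNIV"
    and "t = card A" and "t \<ge> 5"
    and "A = S + T"
    and "card S \<ge> 2" and "card T \<ge> 2"
  shows "3 \<le> card S \<and> real (card S) \<le> real t / 2 \<and>
         3 \<le> card T \<and> real (card T) \<le> real t / 2 \<and>
         (k \<ge> 3 \<longrightarrow> real (card S) < real t / 2 \<and> real (card T) < real t / 2)"
proof -
  interpret proper_generating_subgroup A
  proof
    show "1 \<in> A" "0 \<notin> A"
      unfolding assms(5) power_subgroup_def by (auto intro: exI[of _ 1])
    show "a * b \<in> A" if "a \<in> A" "b \<in> A" for a b
    proof -
      from that obtain x y where "a = x ^ k" "b = y ^ k" "x \<noteq> 0" "y \<noteq> 0"
        unfolding assms(5) power_subgroup_def by auto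
      then have "a * b = (x * y) ^ k" "x * y \<noteq> 0"
        by (simp_all add: power_mult_distrib)
      then show ?thesis unfolding assms(5) power_subgroup_def by blast
    qed
  qed (use assms in auto)
  have TS: "A = T + S" using assms(10) by (simp add: add.commute)
  have t5: "card A \<ge> 5" using assms(8,9) by simp
  show ?thesis
    using two_card_less[OF assms(10,11) t5] three_le_card[OF assms(10,11) t5]
      two_card_less[OF TS assms(12) t5] three_le_card[OF TS assms(12) t5]
    unfolding assms(8) by auto
qed

end
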